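(* Fix $d\ge 1$. For a positive integer $n$ let $K(n)=2n(n-1)(d+2)+1$, fix $n$ such that $2^n>\binom{K(n)}{(d+2)^2}$, and let $K=K(n)$. Let $G_d$ be the bipartite graph on vertex set $A\sqcup B$ where $|A|=n$ and, for every subset $\sigma\subseteq A$, $B$ contains exactly $(d+2)^K$ distinct vertices whose neighbourhood is exactly $\sigma$ (and there are no other vertices or edges). Then for every $1\le d'\le d$, $G_d$ is not $d'$-colorfully representable.
   Context: The graph is regarded as a simplicial complex (empty set, vertices, edges). A word is a finite sequence of letters; a subword is obtained by deleting some letter occurrences. For an alphabet $\sigma$ with $|\sigma|=r\ge2$, a $d$-colorful word on $\sigma$ is a word of length $(d+1)(r-1)+1$ such that for every $i\in[d+1]$ the segment at positions $(i-1)(r-1)+1$ through $i(r-1)+1$ inclusive contains every letter of $\sigma$ exactly once. A simplicial complex $\Delta$ on vertex set $V$ is $d$-colorfully representable if there is a word $W$ on alphabet $V$ such that for every $\sigma\subseteq V$ (with $|\sigma|\ge2$), $\sigma\in\Delta$ iff $W$ contains a $d$-colorful subword on alphabet $\sigma$.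
   Formalization: The formal statement additionally requires n > d; without it the claim fails, e.g. for n = 1, where the binomial coefficient is 0 and the graph (a star plus isolated vertices) is d-colorfully representable, and likewise for every n ≤ d. *)

theory Defs
  imports Complex_Main "HOL-Library.Sublist"
begin

(* Positions in words are counted from 1, so position p of w is w ! (p - 1).
   Consecutive segments overlap in one position. *)
definition colorful_word :: "nat \<Rightarrow> 'a set \<Rightarrow> 'a list \<Rightarrow> bool" where
  "colorful_word d \<sigma> w \<longleftrightarrow>
     2 \<le> card \<sigma> \<and> set w \<subseteq> \<sigma> \<and> length w = (d + 1) * (card \<sigma> - 1) + 1 \<and>
     (\<forall>i\<in>{1..d + 1}. \<forall>x\<in>\<sigma>.
        \<exists>!p. p \<in> {(i - 1) * (card \<sigma> - 1) + 1..i * (card \<sigma> - 1) + 1} \<and> w ! (p - 1) = x)"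

(* The representing word need not use every letter of V. *)
definition colorfully_representable :: "nat \<Rightarrow> 'a set \<Rightarrow> 'a set set \<Rightarrow> bool" where
  "colorfully_representable d V \<Delta> \<longleftrightarrow>
     (\<exists>W. set W \<subseteq> V \<and>
       (\<forall>\<sigma>\<subseteq>V. 2 \<le> card \<sigma> \<longrightarrow>
          (\<sigma> \<in> \<Delta> \<longleftrightarrow> (\<exists>w. subseq w W \<and> colorful_word d \<sigma> w))))"

definition graph_complex :: "'a set \<Rightarrow> 'a set set \<Rightarrow> 'a set set" where
  "graph_complex V E = {{}} \<union> (\<lambda>v. {v}) ` V \<union> E"

definition neighbourhood :: "'a set set \<Rightarrow> 'a \<Rightarrow> 'a set" where
  "neighbourhood E v = {u. {u, v} \<in> E}"

definition K :: "nat \<Rightarrow> nat \<Rightarrow> nat" where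
  "K d n = 2 * n * (n - 1) * (d + 2) + 1"

(* The graph G_d, determined up to isomorphism by d and n, with vertex set A \<union> B and edge set E.
   Since every edge joins A to B, all neighbourhoods of vertices of B are subsets of A,
   so the cardinality condition leaves no further vertices in B (and makes B finite). *)
definition is_G :: "nat \<Rightarrow> nat \<Rightarrow> 'a set \<Rightarrow> 'a set \<Rightarrow> 'a set set \<Rightarrow> bool" where
  "is_G d n A B E \<longleftrightarrow>
     finite A \<and> card A = n \<and> A \<inter> B = {} \<and>
     E \<subseteq> {{a, b} | a b. a \<in> A \<and> b \<in> B} \<and>
     (\<forall>\<sigma>\<subseteq>A. card {b \<in> B. neighbourhood E b = \<sigma>} = (d + 2) ^ K d n)"

lemma is_G_exists:
  "\<exists>A B E. is_G d n (A :: (nat + nat set \<times> nat) set) B E"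
proof -
  define A :: "(nat + nat set \<times> nat) set" where "A = Inl ` {..<n}"
  define B :: "(nat + nat set \<times> nat) set" where
    "B = Inr ` (Pow {..<n} \<times> {..<(d + 2) ^ K d n})"
  define E where "E = {{Inl a, Inr (S, k)} | a S k. a \<in> S \<and> S \<subseteq> {..<n} \<and> k < (d + 2) ^ K d n}"
  have nb: "neighbourhood E (Inr (S, k)) = Inl ` S"
    if "S \<subseteq> {..<n}" "k < (d + 2) ^ K d n" for S k
    using that by (auto simp: neighbourhood_def E_def doubleton_eq_iff)
  have "card {b \<in> B. neighbourhood E b = \<sigma>} = (d + 2) ^ K d n" if \<sigma>: "\<sigma> \<subseteq> A" for \<sigma>
  proof -
    obtain S where S: "S \<subseteq> {..<n}" "\<sigma> = Inl ` S"
      using \<sigma> by (auto simp: A_def subset_image_iff)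
    have "{b \<in> B. neighbourhood E b = \<sigma>} = (\<lambda>k. Inr (S, k)) ` {..<(d + 2) ^ K d n}"
      using S by (auto simp: B_def nb inj_image_eq_iff)
    then show ?thesis by (simp add: card_image inj_on_def)
  qed
  moreover have "E \<subseteq> {{a, b} | a b. a \<in> A \<and> b \<in> B}"
    unfolding E_def A_def B_def by blast
  ultimately have "is_G d n A B E"
    by (auto simp: is_G_def A_def B_def card_image)
  then show ?thesis by blast
qed

(* The theorem is stated for n > d: the bound 2 ^ n > K d n choose (d + 2)^2 is meant for large n, but
   it also holds for degenerate small n, e.g. for n = 1, where the binomial coefficient is 0. For
   1 \<le> n \<le> d the graph is d-colorfully representable: concatenate, for j = 1, ..., n, the words
   (a_j b)^(d + 2) over all neighbours b of a_j, the b's in a fixed order for odd j and in the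
   reversed order for even j. *)

end

(* For a pair {x, y}, a d-colorful word is an alternating word of length d + 2. Since no two letters
   of A alternate that long, a representing word splits into at most 2 + n (n - 1) d' segments, each
   containing at most one letter of A. Two nonadjacent vertices occur together in at most d'
   segments, so among the (d + 2)^K vertices of B with neighbourhood \<sigma>, pigeonhole on the set of
   occupied segments yields one that occupies at most d' segments. These segments, together with
   one bit each telling whether their letter of A lies in \<sigma>, determine \<sigma>: a letter of A sharing
   no segment with b alternates with b in a way depending only on the segments occupied. So 2^n is
   at most the number of such codes, which is at most K choose d. *)

theory Submission
  imports Defs
begin

section \<open>Alternating words and colorful words on pairs\<close>

fun alternating :: "nat \<Rightarrow> 'a \<Rightarrow> 'a \<Rightarrow> 'a list" where
  "alternating 0 x y = []"
| "alternating (Suc m) x y = x # alternating m y x"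

lemma length_alternating [simp]: "length (alternating m x y) = m"
  by (induction m arbitrary: x y) auto

lemma set_alternating: "set (alternating m x y) \<subseteq> {x, y}"
  by (induction m arbitrary: x y) (simp, force)

lemma nth_alternating: "i < m \<Longrightarrow> alternating m x y ! i = (if even i then x else y)"
proof (induction m arbitrary: x y i)
  case (Suc m)
  then show ?case by (cases i) auto
qed simp

lemma subseq_alternating_mono:
  "m \<le> n \<Longrightarrow> subseq (alternating m x y) (alternating n x y)"
proof (induction n arbitrary: m x y)
  case (Suc n)
  then show ?case by (cases m) auto
qed simp

lemma eq_alternating:
  assumes "set w \<subseteq> {x, y}" and "\<And>i. Suc i < length w \<Longrightarrow> w ! i \<noteq> w ! Suc i"
  shows "w = alternating (length w) x y \<or> w = alternating (length w) y x"
  using assms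
proof (induction w)
  case (Cons a w)
  have ne: "w ! i \<noteq> w ! Suc i" if "Suc i < length w" for i
    using Cons.prems(2)[of "Suc i"] that by simp
  have IH: "w = alternating (length w) x y \<or> w = alternating (length w) y x"
    using Cons ne by simp
  show ?case
  proof (cases w)
    case Nil
    then show ?thesis using Cons.prems(1) by auto
  next
    case (Cons b v)
    have "a \<noteq> b" using Cons.prems(2)[of 0] Cons by simp
    with IH Cons Cons.prems(1) show ?thesis by auto
  qed
qed simp

text \<open>On two letters the prescribed segments are the pairs of neighbouring positions. Each
  must hold both letters, so the only condition left is that neighbours differ.\<close>

lemma colorful_word_pair:
  assumes "x \<noteq> y"
  shows "colorful_word d {x, y} w \<longleftrightarrow>
    w = alternating (d + 2) x y \<or> w = alternating (d + 2) y x"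
proof
  assume "colorful_word d {x, y} w"
  moreover have "card {x, y} = 2" using assms by simp
  ultimately have len: "length w = d + 2" and w: "set w \<subseteq> {x, y}"
    and uniq: "\<forall>i\<in>{1..d + 1}. \<forall>z\<in>{x, y}.
      \<exists>!p. p \<in> {(i - 1) * (2 - 1) + 1..i * (2 - 1) + 1} \<and> w ! (p - 1) = z"
    unfolding colorful_word_def by simp_all
  have "w ! i \<noteq> w ! Suc i" if "Suc i < length w" for i
  proof
    assume eq: "w ! i = w ! Suc i"
    have "w ! i \<in> {x, y}" using w that by (meson Suc_lessD nth_mem subsetD)
    \<comment> \<open>Segment number \<open>Suc i\<close> has positions \<open>i + 1\<close> and
      \<open>i + 2\<close>, that is, list indices \<open>i\<close> and \<open>Suc i\<close>.\<close>
    then have "\<exists>!p. p \<in> {i + 1..i + 2} \<and> w ! (p - 1) = w ! i"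
      using uniq[rule_format, of "Suc i" "w ! i"] that len by simp
    moreover have "i + 1 \<in> {i + 1..i + 2} \<and> w ! (i + 1 - 1) = w ! i" by simp
    moreover have "i + 2 \<in> {i + 1..i + 2} \<and> w ! (i + 2 - 1) = w ! i" using eq by simp
    ultimately have "i + 1 = i + 2" by blast
    then show False by simp
  qed
  then show "w = alternating (d + 2) x y \<or> w = alternating (d + 2) y x"
    using eq_alternating[OF w] len by metis
next
  have main: "colorful_word d {u, v} (alternating (d + 2) u v)" if "u \<noteq> v" for u v :: 'a
  proof -
    have "\<exists>!p. p \<in> {(i - 1) * 1 + 1..i * 1 + 1} \<and> alternating (d + 2) u v ! (p - 1) = z"
      if "i \<in> {1..d + 1}" "z \<in> {u, v}" for i z
    proof -
      let ?a = "alternating (d + 2) u v"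
      have p: "p \<in> {(i - 1) * 1 + 1..i * 1 + 1} \<longleftrightarrow> p = i \<or> p = Suc i" for p
        using that by auto
      have a1: "?a ! (i - 1) = (if odd i then u else v)"
        using that by (subst nth_alternating) auto
      have a2: "?a ! (Suc i - 1) = (if even i then u else v)"
        using that by (subst nth_alternating) auto
      have "?a ! (i - 1) \<noteq> ?a ! (Suc i - 1)" "z = ?a ! (i - 1) \<or> z = ?a ! (Suc i - 1)"
        unfolding a1 a2 using \<open>z \<in> {u, v}\<close> \<open>u \<noteq> v\<close> by auto
      then show ?thesis unfolding p by metis
    qed
    then show ?thesis
      using that set_alternating[of "d + 2" u v] by (simp add: colorful_word_def)
  qed
  assume "w = alternating (d + 2) x y \<or> w = alternating (d + 2) y x"
  then show "colorful_word d {x, y} w"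
    using main[of x y] main[of y x] assms by (auto simp: insert_commute)
qed

section \<open>Alternating subwords of concatenated segments\<close>

lemma alternating_subseq_concat:
  assumes "\<And>u. u \<in> set us \<Longrightarrow> x \<in> set u \<and> y \<in> set u"
  shows "subseq (alternating (length us) x y) (concat us)"
  using assms
proof (induction us arbitrary: x y)
  case (Cons u us)
  \<comment> \<open>A single letter is taken from each segment, so the order of \<open>x\<close> and
    \<open>y\<close> inside it does not matter.\<close>
  have "subseq [x] u" using Cons.prems by (simp add: subseq_singleton_left)
  moreover have "subseq (alternating (length us) y x) (concat us)"
    using Cons by simp
  ultimately show ?case
    using list_emb_append_mono[of "(=)" "[x]" u "alternating (length us) y x" "concat us"] by simp
qed simp

lemma subseq_concat_filter: "subseq (concat (filter P us)) (concat us)"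
  by (induction us) (auto intro: list_emb_append_mono list_emb_append2)

lemma subseq_pair_cases:
  assumes "x \<in> set u" "y \<in> set u" "x \<noteq> y"
  shows "subseq [x, y] u \<or> subseq [y, x] u"
  using assms
proof (induction u)
  case (Cons a u)
  then show ?case by (auto simp: subseq_singleton_left)
qed simp

text \<open>The first common segment contributes both letters, every later one the letter needed next.\<close>

lemma alternating_Suc_subseq_concat:
  assumes "x \<noteq> y" and "\<And>u. u \<in> set us \<Longrightarrow> x \<in> set u \<and> y \<in> set u" and "us \<noteq> []"
  shows "subseq (alternating (Suc (length us)) x y) (concat us) \<or>
    subseq (alternating (Suc (length us)) y x) (concat us)"
proof -
  obtain u vs where us: "us = u # vs" using assms(3) by (cases us) auto
  have *: "subseq (alternating (length vs) x y) (concat vs)"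
    "subseq (alternating (length vs) y x) (concat vs)"
    using assms(2) us by (auto intro!: alternating_subseq_concat)
  have "subseq [x, y] u \<or> subseq [y, x] u"
    using assms us by (intro subseq_pair_cases) auto
  then show ?thesis
    using list_emb_append_mono[OF _ *(1), of "[x, y]" u]
      list_emb_append_mono[OF _ *(2), of "[y, x]" u] us by auto
qed

text \<open>If no segment holds both letters, each segment supplies at most one letter of the
  alternating word, so only the sets of segments occupied by the two letters count. Both letters are
  replaceable in the statement because the induction exchanges their roles.\<close>

lemma alternating_subseq_replace:
  assumes "\<And>u. u \<in> set us \<Longrightarrow> (x \<in> set u \<longleftrightarrow> x' \<in> set u) \<and> (y \<in> set u \<longleftrightarrow> y' \<in> set u)"
    and "\<And>u. u \<in> set us \<Longrightarrow> \<not> (x \<in> set u \<and> y \<in> set u)"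
    and "subseq (alternating m x y) (concat us)"
  shows "subseq (alternating m x' y') (concat us)"
  using assms
proof (induction us arbitrary: m x y x' y')
  case Nil
  then show ?case by (cases m) auto
next
  case (Cons u us)
  from Cons.prems(3) obtain w1 w2 where w: "alternating m x y = w1 @ w2"
    "subseq w1 u" "subseq w2 (concat us)"
    by (auto elim: subseq_appendE)
  have sub: "set w1 \<subseteq> set u" using w(2) by (blast elim: list_emb_set)
  show ?case
  proof (cases w1)
    case Nil
    with w have "subseq (alternating m x y) (concat us)" by simp
    then have "subseq (alternating m x' y') (concat us)"
      using Cons.prems by (intro Cons.IH[of x x' y y']) auto
    then show ?thesis by (simp add: list_emb_append2)
  next
    case (Cons c v)
    then obtain k where m: "m = Suc k" using w(1) by (cases m) auto
    have c: "c = x" "alternating k y x = v @ w2" using w(1) Cons m by auto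
    \<comment> \<open>A second letter taken from \<open>u\<close> would have to be \<open>y\<close>,
      which cannot share \<open>u\<close> with \<open>x\<close>.\<close>
    have "v = []"
    proof (rule ccontr)
      assume "v \<noteq> []"
      then have "hd v = y" using c(2) by (cases k; cases v) auto
      then have "y \<in> set u" "x \<in> set u"
        using sub Cons c \<open>v \<noteq> []\<close> by (auto simp: hd_in_set)
      then show False using Cons.prems(2) by auto
    qed
    have "subseq (alternating k y x) (concat us)" using c \<open>v = []\<close> w(3) by simp
    then have "subseq (alternating k y' x') (concat us)"
      using Cons.prems by (intro Cons.IH[of y y' x x']) auto
    moreover have "subseq [x'] u"
      using sub Cons c Cons.prems(1)[of u] by (simp add: subseq_singleton_left)
    ultimately show ?thesis
      using list_emb_append_mono[of "(=)" "[x']" u] m by fastforce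
  qed
qed

section \<open>Cutting a word into segments with at most one letter of A each\<close>

fun steps :: "'a \<Rightarrow> 'a \<Rightarrow> 'a list \<Rightarrow> nat" where
  "steps x y (u # v # w) = (if u = x \<and> v = y then 1 else 0) + steps x y (v # w)"
| "steps x y w = 0"

text \<open>Since \<open>x\<close> and \<open>y\<close> differ, occurrences of the factor
  \<open>x y\<close> do not overlap; read one after another they spell the alternating word.\<close>

lemma alternating_steps_subseq:
  "x \<noteq> y \<Longrightarrow> subseq (alternating (2 * steps x y w) x y) w"
proof (induction x y w rule: steps.induct)
  case (1 x y u v w)
  show ?case
  proof (cases "u = x \<and> v = y")
    case True
    \<comment> \<open>Here \<open>v = y\<close>, and a nonempty alternating word starting with
      \<open>x\<close> does not use it.\<close>
    have "subseq (alternating (2 * steps x y (v # w)) x y) w"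
      using 1 True by (cases "steps x y (v # w)") auto
    then show ?thesis using True by simp
  next
    case False
    then show ?thesis using 1 by (auto intro: subseq_Cons')
  qed
qed auto

text \<open>Every new run after the first begins with a change of letter, and such a change is
  counted by exactly one ordered pair.\<close>

lemma length_remdups_adj_le_steps:
  assumes "finite A" "set w \<subseteq> A"
  shows "length (remdups_adj w) \<le> Suc (\<Sum>(x, y)\<in>{(x, y). x \<in> A \<and> y \<in> A \<and> x \<noteq> y}. steps x y w)"
  using assms(2)
proof (induction w rule: remdups_adj.induct)
  case (3 u v w)
  let ?P = "{(x, y). x \<in> A \<and> y \<in> A \<and> x \<noteq> y}"
  have fin: "finite ?P"
    by (rule finite_subset[of _ "A \<times> A"]) (use assms in auto)
  have "(\<Sum>(x, y)\<in>?P. steps x y (u # v # w)) =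
      (\<Sum>p\<in>?P. if (u, v) = p then 1 else 0) + (\<Sum>(x, y)\<in>?P. steps x y (v # w))"
    unfolding sum.distrib[symmetric] by (intro sum.cong) (auto split: prod.splits)
  also have "(\<Sum>p\<in>?P. if (u, v) = p then 1 else 0) = (if u = v then 0 else 1 :: nat)"
    using 3 fin by (subst sum.delta') auto
  finally show ?case using 3 by (cases "u = v") auto
qed auto

text \<open>The cuts fall right after the last letter of each run of equal letters in the A-subword,
  except the last run. The condition on \<open>set u\<close> serves the induction: it tells when a
  prepended letter of A may join the first segment.\<close>

lemma segmentation:
  "\<exists>u us. w = concat (u # us) \<and> (\<forall>v\<in>set (u # us). \<exists>a. set v \<inter> A \<subseteq> {a}) \<and>
    set u \<inter> A \<subseteq> set (take 1 (filter (\<lambda>x. x \<in> A) w)) \<and>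
    length us \<le> length (remdups_adj (filter (\<lambda>x. x \<in> A) w))"
proof (induction w)
  case Nil
  then show ?case by (intro exI[of _ "[]"]) auto
next
  case (Cons x w)
  then obtain u us where w: "w = concat (u # us)"
    and seg: "\<forall>v\<in>set (u # us). \<exists>a. set v \<inter> A \<subseteq> {a}"
    and hd: "set u \<inter> A \<subseteq> set (take 1 (filter (\<lambda>x. x \<in> A) w))"
    and len: "length us \<le> length (remdups_adj (filter (\<lambda>x. x \<in> A) w))"
    by blast
  consider "x \<notin> A" | "x \<in> A" "filter (\<lambda>x. x \<in> A) w = []"
    | y ys where "x \<in> A" "filter (\<lambda>x. x \<in> A) w = y # ys"
    by (cases "filter (\<lambda>x. x \<in> A) w") auto
  then show ?case
  proof cases
    case 1
    then show ?thesis using w seg hd len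
      by (intro exI[of _ "x # u"] exI[of _ us]) auto
  next
    case 2
    then show ?thesis using w seg hd len
      by (intro exI[of _ "x # u"] exI[of _ us]) auto
  next
    case 3
    show ?thesis
    proof (cases "x = y")
      case True
      have "set u \<inter> A \<subseteq> {y}" using hd 3 by simp
      then show ?thesis using w seg len 3 True
        by (intro exI[of _ "x # u"] exI[of _ us]) auto
    next
      case False
      then show ?thesis using w seg hd len 3
        by (intro exI[of _ "[x]"] exI[of _ "u # us"]) auto
    qed
  qed
qed

section \<open>Binomial estimates\<close>

lemma card_subsets_card_le:
  assumes "finite X"
  shows "card {C. C \<subseteq> X \<and> card C \<le> d} \<le> (card X + d) choose d"
proof -
  have "{C. C \<subseteq> X \<and> card C \<le> d} = (\<Union>k\<le>d. {C. C \<subseteq> X \<and> card C = k})" by auto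
  then have "card {C. C \<subseteq> X \<and> card C \<le> d} \<le> (\<Sum>k\<le>d. card {C. C \<subseteq> X \<and> card C = k})"
    by (simp add: card_UN_le)
  also have "\<dots> = (\<Sum>k\<le>d. card X choose k)" using assms by (simp add: n_subsets)
  \<comment> \<open>The inserted factors are at least 1 and turn the sum into a Vandermonde
    convolution.\<close>
  also have "\<dots> \<le> (\<Sum>k\<le>d. (card X choose k) * (d choose (d - k)))"
    by (intro sum_mono) (simp add: Suc_leI)
  also have "\<dots> = (card X + d) choose d" by (rule vandermonde)
  finally show ?thesis .
qed

text \<open>By symmetry and unimodality of the binomial coefficients, the minimum over indices
  between \<open>k\<close> and \<open>n - k\<close> is attained at the ends.\<close>

lemma binomial_le_binomial:
  assumes "k \<le> q" "k + q \<le> n"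
  shows "n choose k \<le> n choose q"
proof (cases "2 * q \<le> n")
  case True
  then show ?thesis using assms by (intro binomial_mono) auto
next
  case False
  have "n choose k \<le> n choose (n - q)" using assms False by (intro binomial_mono) auto
  also have "\<dots> = n choose q" using assms by (subst binomial_symmetric[symmetric]) auto
  finally show ?thesis .
qed

section \<open>Bounds on the number of segments and of common segments\<close>

lemma segmentation_bound:
  assumes "finite A" "1 \<le> d"
    and "\<And>x y. x \<in> A \<Longrightarrow> y \<in> A \<Longrightarrow> x \<noteq> y \<Longrightarrow> \<not> subseq (alternating (d + 2) x y) w"
  shows "\<exists>us. w = concat us \<and> (\<forall>u\<in>set us. \<exists>a. set u \<inter> A \<subseteq> {a}) \<and>
    length us \<le> 2 + card A * (card A - 1) * d"
proof -
  let ?w = "filter (\<lambda>x. x \<in> A) w" and ?P = "{(x, y). x \<in> A \<and> y \<in> A \<and> x \<noteq> y}"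
  have "steps x y ?w \<le> d" if "x \<in> A" "y \<in> A" "x \<noteq> y" for x y
  proof (rule ccontr)
    assume "\<not> steps x y ?w \<le> d"
    \<comment> \<open>At least \<open>d + 1\<close> steps already give an alternating word of length
      \<open>2 * d + 2\<close>.\<close>
    then have "d + 2 \<le> 2 * steps x y ?w" using assms(2) by simp
    then have "subseq (alternating (d + 2) x y) (alternating (2 * steps x y ?w) x y)"
      by (rule subseq_alternating_mono)
    also have "subseq \<dots> ?w" using that by (intro alternating_steps_subseq)
    also have "subseq \<dots> w" by simp
    finally show False using assms(3) that by blast
  qed
  then have "(\<Sum>(x, y)\<in>?P. steps x y ?w) \<le> card ?P * d"
    by (intro sum_bounded_above[of ?P _ d, simplified]) auto
  moreover have "?P = Sigma A (\<lambda>x. A - {x})" by auto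
  then have "card ?P = card A * (card A - 1)"
    using assms(1) by (simp add: card_Diff_singleton)
  ultimately have "length (remdups_adj ?w) \<le> Suc (card A * (card A - 1) * d)"
    using length_remdups_adj_le_steps[OF assms(1), of ?w] by (fastforce intro: order_trans)
  moreover obtain u us where "w = concat (u # us)" "\<forall>v\<in>set (u # us). \<exists>a. set v \<inter> A \<subseteq> {a}"
    "length us \<le> length (remdups_adj ?w)"
    using segmentation[of w A] by blast
  \<comment> \<open>The constant 2 comes from the first run and from the extra segment
    \<open>u\<close>.\<close>
  ultimately show ?thesis by (intro exI[of _ "u # us"]) auto
qed

text \<open>With \<open>d + 1\<close> common segments, \<open>alternating_Suc_subseq_concat\<close>
  would produce an alternating word of length \<open>d + 2\<close>.\<close>

lemma card_common_segments_le:
  assumes "x \<noteq> y" and "\<not> subseq (alternating (d + 2) x y) (concat us)"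
    and "\<not> subseq (alternating (d + 2) y x) (concat us)"
  shows "card {j. j < length us \<and> x \<in> set (us ! j) \<and> y \<in> set (us ! j)} \<le> d"
proof (rule ccontr)
  assume many: "\<not> ?thesis"
  let ?vs = "filter (\<lambda>u. x \<in> set u \<and> y \<in> set u) us"
  have len: "d < length ?vs" using many by (simp add: length_filter_conv_card)
  have "subseq (alternating (Suc (length ?vs)) x y) (concat ?vs) \<or>
      subseq (alternating (Suc (length ?vs)) y x) (concat ?vs)"
    using assms(1) len by (intro alternating_Suc_subseq_concat) auto
  moreover have "subseq (alternating (d + 2) u v) (alternating (Suc (length ?vs)) u v)" for u v :: 'a
    using len by (intro subseq_alternating_mono) simp
  ultimately show False
    using assms(2,3) subseq_concat_filter[of _ us] by (meson subseq_order.order_trans)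
qed

section \<open>Encoding the subsets of A by occupied segments\<close>

theorem theorem4p1:
  fixes d n d' :: nat and A B :: "'a set" and E :: "'a set set"
  assumes "1 \<le> d"
    and "1 \<le> n"
    and "d < n"
    and "2 ^ n > K d n choose (d + 2)\<^sup>2"
    and "is_G d n A B E"
    and "1 \<le> d'" and "d' \<le> d"
  shows "\<not> colorfully_representable d' (A \<union> B) (graph_complex (A \<union> B) E)"
proof
  assume "colorfully_representable d' (A \<union> B) (graph_complex (A \<union> B) E)"
  then obtain W where W: "\<And>\<sigma>. \<sigma> \<subseteq> A \<union> B \<Longrightarrow> 2 \<le> card \<sigma> \<Longrightarrow>
      \<sigma> \<in> graph_complex (A \<union> B) E \<longleftrightarrow> (\<exists>w. subseq w W \<and> colorful_word d' \<sigma> w)"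
    unfolding colorfully_representable_def by blast
  have G: "finite A" "card A = n" "A \<inter> B = {}" "E \<subseteq> {{a, b} | a b. a \<in> A \<and> b \<in> B}"
    and fibre: "\<And>\<sigma>. \<sigma> \<subseteq> A \<Longrightarrow> card {b \<in> B. neighbourhood E b = \<sigma>} = (d + 2) ^ K d n"
    using assms(5) by (auto simp: is_G_def)
  let ?adj = "\<lambda>x y. subseq (alternating (d' + 2) x y) W"
  have edge: "{x, y} \<in> E \<longleftrightarrow> ?adj x y \<or> ?adj y x"
    if "x \<in> A \<union> B" "y \<in> A \<union> B" "x \<noteq> y" for x y
  proof -
    \<comment> \<open>A set of two elements is neither empty nor a singleton, so it is in the
      complex only as an edge.\<close>
    have "{x, y} \<in> E \<longleftrightarrow> {x, y} \<in> graph_complex (A \<union> B) E"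
      using that by (auto simp: graph_complex_def doubleton_eq_iff)
    also have "\<dots> \<longleftrightarrow> (\<exists>w. subseq w W \<and> colorful_word d' {x, y} w)"
      using that by (intro W) auto
    also have "\<dots> \<longleftrightarrow> ?adj x y \<or> ?adj y x"
      unfolding colorful_word_pair[OF that(3)] by blast
    finally show ?thesis .
  qed
  have nonedge: "{x, y} \<notin> E" if "x \<in> A \<and> y \<in> A \<or> x \<in> B \<and> y \<in> B" for x y
  proof
    assume "{x, y} \<in> E"
    then obtain a b where "{x, y} = {a, b}" "a \<in> A" "b \<in> B" using G(4) by blast
    then show False using that G(3) by (auto simp: doubleton_eq_iff)
  qed
  have "\<not> ?adj x y" if "x \<in> A" "y \<in> A" "x \<noteq> y" for x y
    using edge[of x y] nonedge[of x y] that by blast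
  then obtain us where us: "W = concat us" "\<And>u. u \<in> set us \<Longrightarrow> \<exists>a. set u \<inter> A \<subseteq> {a}"
    "length us \<le> 2 + card A * (card A - 1) * d'"
    using segmentation_bound[OF G(1) assms(6), of W] by blast
  define R where "R = length us"
  define N where "N = n * (n - 1)"
  \<comment> \<open>From \<open>d < n\<close> follow \<open>d + 1 \<le> n\<close> and
    \<open>d \<le> n - 1\<close>. This lets \<open>N\<close> absorb the lower-order terms in the
    comparisons with \<open>K d n\<close>.\<close>
  have "(d + 1) * d \<le> N"
    unfolding N_def using assms(3) by (intro mult_le_mono) auto
  then have N: "d * d + d \<le> N" by (simp add: algebra_simps)
  have sq: "d \<le> d * d" using assms(1) by simp
  have "R \<le> 2 + N * d'" using us(3) G(2) by (simp add: R_def N_def)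
  also have "\<dots> \<le> 2 + N * d" using assms(7) by simp
  finally have R: "R \<le> 2 + N * d" .
  have K_eq: "K d n = 2 * (N * d) + 4 * N + 1"
    unfolding K_def N_def by (simp add: algebra_simps)
  \<comment> \<open>\<open>R * 2\<close> counts pairs of a segment and a bit; the summand
    \<open>d\<close> comes from \<open>card_subsets_card_le\<close>.\<close>
  have RK: "R * 2 + d \<le> K d n"
    using R N sq assms(1) unfolding K_eq by linarith
  have "N \<le> N * d" using assms(1) by simp
  moreover have "(d + 2)\<^sup>2 = d * d + 4 * d + 4" by (simp add: power2_eq_square)
  \<comment> \<open>This is the side condition for passing from \<open>choose d\<close> to
    \<open>choose (d + 2)\<^sup>2\<close> at the end.\<close>
  ultimately have dK: "d + (d + 2)\<^sup>2 \<le> K d n"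
    using N sq assms(1) unfolding K_eq by linarith

  define occ where "occ b = {j. j < R \<and> b \<in> set (us ! j)}" for b
  have "\<exists>b\<in>B. neighbourhood E b = \<sigma> \<and> card (occ b) \<le> d" if \<sigma>: "\<sigma> \<subseteq> A" for \<sigma>
  proof -
    let ?F = "{b \<in> B. neighbourhood E b = \<sigma>}"
    have "occ ` ?F \<subseteq> Pow {..<R}" by (auto simp: occ_def)
    then have "card (occ ` ?F) \<le> 2 ^ R"
      by (metis card_Pow card_lessThan card_mono finite_Pow_iff finite_lessThan)
    also have "\<dots> \<le> 2 ^ K d n" using RK by (intro power_increasing) auto
    \<comment> \<open>Strictness needs a base above 2 and a positive exponent; the summand 1 in
      \<open>K\<close> ensures the latter.\<close>
    also have "\<dots> < (d + 2) ^ K d n"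
      using assms(1) by (intro power_strict_mono) (auto simp: K_def)
    also have "\<dots> = card ?F" using fibre \<sigma> by simp
    finally obtain b b' where b: "b \<in> ?F" "b' \<in> ?F" "b \<noteq> b'" "occ b = occ b'"
      using pigeonhole[of occ ?F] by (auto simp: inj_on_def)
    then have "\<not> ?adj b b'" "\<not> ?adj b' b" using edge[of b b'] nonedge[of b b'] by auto
    \<comment> \<open>As \<open>occ b = occ b'\<close>, this intersection is all of
      \<open>occ b\<close>.\<close>
    then have "card (occ b \<inter> occ b') \<le> d'"
      using card_common_segments_le[of b b' d' us] b(3) us(1)
      by (auto simp: occ_def R_def Int_def conj_ac)
    then show ?thesis using b assms(7) by auto
  qed
  then obtain f where f: "\<And>\<sigma>. \<sigma> \<subseteq> A \<Longrightarrow> f \<sigma> \<in> B"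
    "\<And>\<sigma>. \<sigma> \<subseteq> A \<Longrightarrow> neighbourhood E (f \<sigma>) = \<sigma>" "\<And>\<sigma>. \<sigma> \<subseteq> A \<Longrightarrow> card (occ (f \<sigma>)) \<le> d"
    by metis

  \<comment> \<open>The bit is \<open>False\<close> exactly when the segment contains a letter of
    \<sigma>.\<close>
  define code where "code \<sigma> = (\<lambda>j. (j, set (us ! j) \<inter> \<sigma> = {})) ` occ (f \<sigma>)" for \<sigma>
  \<comment> \<open>One inclusion suffices for injectivity, since \<sigma> and \<tau> may be
    exchanged.\<close>
  have sub: "\<sigma> \<subseteq> \<tau>" if "\<sigma> \<subseteq> A" "\<tau> \<subseteq> A" "code \<sigma> = code \<tau>" for \<sigma> \<tau>
  proof
    fix a assume a: "a \<in> \<sigma>"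
    have occ: "occ (f \<sigma>) = occ (f \<tau>)"
      using arg_cong[OF that(3), of "(`) fst"] by (simp add: code_def image_image)
    show "a \<in> \<tau>"
    proof (cases "\<exists>j\<in>occ (f \<sigma>). a \<in> set (us ! j)")
      case True
      then obtain j where j: "j \<in> occ (f \<sigma>)" "a \<in> set (us ! j)" by blast
      then have "(j, False) \<in> code \<sigma>" using a by (force simp: code_def)
      \<comment> \<open>Equal codes make this segment meet \<tau> as well, and \<open>a\<close> is
        its only letter of A.\<close>
      then have "set (us ! j) \<inter> \<tau> \<noteq> {}" using that(3) by (auto simp: code_def)
      moreover obtain c where "set (us ! j) \<inter> A \<subseteq> {c}"
        using us(2)[of "us ! j"] j(1) by (auto simp: occ_def R_def)
      ultimately show ?thesis using a j(2) that(1,2) by blast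
    next
      case False
      \<comment> \<open>Here \<open>a\<close> shares no segment with \<open>f \<sigma>\<close>, so
        \<open>f \<tau>\<close>, which occupies the same segments, can replace
        \<open>f \<sigma>\<close> in any alternation with \<open>a\<close>.\<close>
      have same: "f \<sigma> \<in> set u \<longleftrightarrow> f \<tau> \<in> set u" "\<not> (a \<in> set u \<and> f \<sigma> \<in> set u)"
        if u: "u \<in> set us" for u
      proof -
        obtain j where j: "j < R" "u = us ! j" using u by (auto simp: in_set_conv_nth R_def)
        show "f \<sigma> \<in> set u \<longleftrightarrow> f \<tau> \<in> set u" using occ j by (auto simp: occ_def)
        show "\<not> (a \<in> set u \<and> f \<sigma> \<in> set u)" using False j by (auto simp: occ_def)
      qed
      have aA: "a \<in> A" "a \<noteq> f \<sigma>" "a \<noteq> f \<tau>" using a that f(1) G(3) by auto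
      have "{a, f \<sigma>} \<in> E" using f(2)[OF that(1)] a by (auto simp: neighbourhood_def)
      then have "?adj a (f \<sigma>) \<or> ?adj (f \<sigma>) a" using edge[of a "f \<sigma>"] aA f(1) that(1) by auto
      then have "?adj a (f \<tau>) \<or> ?adj (f \<tau>) a"
        using alternating_subseq_replace[of us a a "f \<sigma>" "f \<tau>"]
          alternating_subseq_replace[of us "f \<sigma>" "f \<tau>" a a] same us(1) by blast
      then have "{a, f \<tau>} \<in> E" using edge[of a "f \<tau>"] aA f(1) that(2) by auto
      then show ?thesis using f(2)[OF that(2)] by (auto simp: neighbourhood_def)
    qed
  qed
  let ?X = "{..<R} \<times> (UNIV :: bool set)"
  have "inj_on code (Pow A)" by (intro inj_onI equalityI) (simp_all add: sub)
  moreover have "code ` Pow A \<subseteq> {C. C \<subseteq> ?X \<and> card C \<le> d}"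
  proof (intro image_subsetI CollectI conjI)
    fix \<sigma> assume "\<sigma> \<in> Pow A"
    show "code \<sigma> \<subseteq> ?X" by (auto simp: code_def occ_def)
    have "card (code \<sigma>) \<le> card (occ (f \<sigma>))"
      unfolding code_def by (rule card_image_le) (simp add: occ_def)
    then show "card (code \<sigma>) \<le> d" using f(3)[of \<sigma>] \<open>\<sigma> \<in> Pow A\<close> by simp
  qed
  ultimately have "card (Pow A) \<le> card {C. C \<subseteq> ?X \<and> card C \<le> d}"
    by (intro card_inj_on_le) auto
  also have "\<dots> \<le> (card ?X + d) choose d" by (intro card_subsets_card_le) auto
  also have "card ?X = R * 2" by simp
  also have "(R * 2 + d) choose d \<le> K d n choose d" using RK by (rule binomial_right_mono)
  also have "\<dots> \<le> K d n choose (d + 2)\<^sup>2"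
    using dK by (intro binomial_le_binomial) (auto simp: power2_eq_square)
  finally show False using assms(4) G(1,2) by (simp add: card_Pow)
qed

end
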